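(* In the abstract setting of the context (spaces $Y\subseteq Z\subseteq O$, forms $a,c$ with operators $A,C$, discrete spaces $X_n\subset Z$ with forms $a_n,c_n$), suppose: (i) there is a dense subset $Y^\infty$ of $Y$ such that for all $u\in Y^\infty$ there is a sequence $u_n\in X_n$ such that $u_n\to u$ in $Z$ and $$\lim_{n\to\infty}\ \sup_{v\in X_n\setminus\{0\}}\frac{|a(u,v)-a_n(u_n,v)|}{\|v\|_Z}=0;$$ (ii) with $G$ the kernel of $a$ and $G_n$ the kernel of $a_n$, $\delta(G_n,G)\to0$ in the norm of $Z$; (iii) there is a sequence $(\epsilon_n)$ of positive reals converging to $0$ such that $|c(u,v)-c_n(u,v)|\le\epsilon_n\|u\|_Z\|v\|_Z$ for all $n$ and all $u,v\in X_n$; (iv) with $\tilde X_n=X_n\cap G_n^\perp$ (orthogonal in $O$), there is $\beta>0$ such that for all $n$ $$\inf_{u\in\tilde X_n\setminus\{0\}}\ \sup_{v\in X_n\setminus\{0\}}\frac{|a_n(u,v)|}{\|u\|_Z\|v\|_Z}\ge\beta;$$ (v) $A+C:Y\to O$ is injective. Then there is $\beta'>0$ such that for all $n$ large enough: $$\inf_{u\in X_n\setminus\{0\}}\ \sup_{v\in X_n\setminus\{0\}}\frac{|a_n(u,v)+c_n(u,v)|}{\|u\|_Z\|v\|_Z}\ge\beta' .$$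
   Context: $O$ is a separable Hilbert space with scalar product $\langle\cdot,\cdot\rangle$ and norm $|\cdot|$. $Y$ is a Hilbert space which is dense and compactly embedded in $O$. $a$ is a bilinear form which is continuous and symmetric on $Y\times Y$ and extends continuously to $Y\times O$ and $O\times Y$. The operator $A:Y\to O$ is defined by $\langle Au,v\rangle=a(u,v)$ for $u\in Y$, $v\in O$, and is assumed to be Fredholm (of index $0$ by symmetry). The kernel $G$ of $a$ is $\ker A$, which is finite dimensional. $C:O\to O$ is bounded and symmetric, and $c(u,v)=\langle Cu,v\rangle$. $Z$ is a space, with norm $\|\cdot\|_Z$, intermediate between $O$ and $Y$, i.e. $Y\subseteq Z\subseteq O$ with continuous inclusions, and the injection $Z\to O$ is compact. For each $n\in\mathbb N$, $X_n$ is a finite dimensional subspace of $Z$, equipped with symmetric bilinear forms $a_n$ and $c_n$; $G_n=\{u\in X_n: a_n(u,v)=0\ \forall v\in X_n\}$. The gap between subspaces $E,F$ of a normed space is $\delta(E,F)=\sup_{u\in E,\|u\|=1}\ \inf_{v\in F}\|u-v\|$ (equal to $0$ if $E=0$).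
   Formalization: That the Fredholm operator A has index 0 is assumed here; it does not follow from symmetry (A = d²/dx² on H²₀(0,1) has index −2), and without it the claim fails (Z = H¹₀, C = π² Id, P1 elements). *)

theory Defs
  imports "HOL-Analysis.Analysis"
begin

section \<open>Linear algebra and operators\<close>

definition finite_dim :: "'a::real_vector set \<Rightarrow> bool" where
  "finite_dim S \<longleftrightarrow> (\<exists>B. finite B \<and> span B = S)"

definition symmetric_bilinear_on :: "'a::real_vector set \<Rightarrow> ('a \<Rightarrow> 'a \<Rightarrow> real) \<Rightarrow> bool" where
  "symmetric_bilinear_on S b \<longleftrightarrow>
     (\<forall>u\<in>S. \<forall>v\<in>S. b u v = b v u) \<and>
     (\<forall>u\<in>S. \<forall>v\<in>S. \<forall>w\<in>S. b (u + v) w = b u w + b v w) \<and>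
     (\<forall>r. \<forall>u\<in>S. \<forall>v\<in>S. b (r *\<^sub>R u) v = r * b u v)"

definition form_kernel :: "'a set \<Rightarrow> ('a \<Rightarrow> 'a \<Rightarrow> real) \<Rightarrow> 'a set" where
  "form_kernel S b = {u\<in>S. \<forall>v\<in>S. b u v = 0}"

definition continuous_embedding :: "('a::real_normed_vector \<Rightarrow> 'b::real_normed_vector) \<Rightarrow> bool" where
  "continuous_embedding j \<longleftrightarrow> bounded_linear j \<and> inj j"

definition compact_map :: "('a::real_normed_vector \<Rightarrow> 'b::real_normed_vector) \<Rightarrow> bool" where
  "compact_map j \<longleftrightarrow> (\<forall>B. bounded B \<longrightarrow> compact (closure (j ` B)))"

text \<open>
  The codimension of the range is the dimension of any algebraic complement
  \<open>W\<close>; \<open>dim\<close> is meaningful here because both subspaces are required to be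
  finite dimensional.
\<close>

definition fredholm_of_index ::
    "int \<Rightarrow> ('a::real_normed_vector \<Rightarrow> 'b::real_normed_vector) \<Rightarrow> bool" where
  "fredholm_of_index k T \<longleftrightarrow>
     bounded_linear T \<and> finite_dim {u. T u = 0} \<and> closed (range T) \<and>
     (\<exists>W. finite_dim W \<and> range T \<inter> W = {0} \<and> (\<forall>y. \<exists>x. \<exists>w\<in>W. y = T x + w) \<and>
          int (dim {u. T u = 0}) - int (dim W) = k)"

text \<open>
  The operator representing a form that is continuous in its second, Hilbert
  space, argument; the described vector exists uniquely by the Riesz theorem.
\<close>

definition induced_operator :: "('a \<Rightarrow> 'b::real_inner \<Rightarrow> real) \<Rightarrow> 'a \<Rightarrow> 'b" where
  "induced_operator b u = (THE w. \<forall>v. w \<bullet> v = b u v)"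

section \<open>Gap and inf-sup constant\<close>

text \<open>
  Suprema and infima are taken in \<open>[0, \<infinity>]\<close>, so that an empty supremum is \<open>0\<close>
  and an empty infimum is \<open>\<infinity>\<close>.
\<close>

definition gap :: "'a::real_normed_vector set \<Rightarrow> 'a set \<Rightarrow> ennreal" where
  "gap E F = (SUP u\<in>{u\<in>E. norm u = 1}. INF v\<in>F. ennreal (norm (u - v)))"

definition inf_sup ::
    "'a::real_normed_vector set \<Rightarrow> 'a set \<Rightarrow> ('a \<Rightarrow> 'a \<Rightarrow> real) \<Rightarrow> ennreal" where
  "inf_sup U V b =
     (INF u\<in>U - {0}. SUP v\<in>V - {0}. ennreal (\<bar>b u v\<bar> / (norm u * norm v)))"

section \<open>The abstract setting\<close>

text \<open>
  The inclusions of \<open>Y\<close> in \<open>Z\<close> and of \<open>Z\<close> in \<open>O\<close> are the maps \<open>\<kappa>\<close> and \<open>\<iota>\<close>.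
  \<open>aO\<close> is the continuous extension of \<open>a\<close> to \<open>Y \<times> O\<close>, unique by density.

  Index \<open>0\<close> has to be an assumption on \<open>A\<close>, as it does not follow from
  symmetry: \<open>a(u,v) = \<integral> u'' v\<close> with \<open>Y = H\<^sup>2\<^sub>0(0,1)\<close> and \<open>O = L\<^sup>2(0,1)\<close> is
  symmetric, extends to \<open>Y \<times> O\<close> and to \<open>O \<times> Y\<close>, and its operator is Fredholm of
  index \<open>-2\<close>.
\<close>

locale abstract_setting =
  fixes \<kappa> :: "'y::{real_inner,complete_space} \<Rightarrow> 'z::real_normed_vector"
    and \<iota> :: "'z \<Rightarrow> 'o::{real_inner,complete_space}"
    and a :: "'y \<Rightarrow> 'y \<Rightarrow> real"
    and aO :: "'y \<Rightarrow> 'o \<Rightarrow> real"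
    and C :: "'o \<Rightarrow> 'o"
  assumes separable_O: "separable_space (euclidean :: 'o topology)"
    and embedding_YZ: "continuous_embedding \<kappa>"
    and embedding_ZO: "continuous_embedding \<iota>"
    and compact_ZO: "compact_map \<iota>"
    and compact_YO: "compact_map (\<iota> \<circ> \<kappa>)"
    and dense_YO: "closure (range (\<iota> \<circ> \<kappa>)) = UNIV"
    and continuous_a: "bounded_bilinear a"
    and symmetric_a: "\<And>u v. a u v = a v u"
    and continuous_aO: "bounded_bilinear aO"
    and extends_aO: "\<And>u v. aO u (\<iota> (\<kappa> v)) = a u v"
    and extends_OY:
      "\<exists>b :: 'o \<Rightarrow> 'y \<Rightarrow> real. bounded_bilinear b \<and> (\<forall>u v. b (\<iota> (\<kappa> u)) v = a u v)"
    and fredholm_A: "fredholm_of_index 0 (induced_operator aO)"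
    and bounded_C: "bounded_linear C"
    and symmetric_C: "\<And>u v. C u \<bullet> v = u \<bullet> C v"

locale discrete_setting = abstract_setting \<kappa> \<iota> a aO C
  for \<kappa> :: "'y::{real_inner,complete_space} \<Rightarrow> 'z::real_normed_vector"
    and \<iota> :: "'z \<Rightarrow> 'o::{real_inner,complete_space}"
    and a :: "'y \<Rightarrow> 'y \<Rightarrow> real"
    and aO :: "'y \<Rightarrow> 'o \<Rightarrow> real"
    and C :: "'o \<Rightarrow> 'o" +
  fixes X :: "nat \<Rightarrow> 'z set"
    and an :: "nat \<Rightarrow> 'z \<Rightarrow> 'z \<Rightarrow> real"
    and cn :: "nat \<Rightarrow> 'z \<Rightarrow> 'z \<Rightarrow> real"
  assumes finite_dim_X: "\<And>n. finite_dim (X n)"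
    and bilinear_an: "\<And>n. symmetric_bilinear_on (X n) (an n)"
    and bilinear_cn: "\<And>n. symmetric_bilinear_on (X n) (cn n)"

end

theory Submission
  imports Defs
begin

text \<open>
  Argue by contradiction with normalised \<open>u\<^sub>k \<in> X\<^sub>n\<close> whose residuals tend to \<open>0\<close>. By
  compactness \<open>u\<^sub>k \<rightarrow> w\<close> in \<open>O\<close> along a subsequence, and testing against the approximants
  of \<open>v \<in> Y\<^sup>\<infinity>\<close> shows that \<open>w\<close> is orthogonal to \<open>(A + C) v\<close>. Since \<open>A\<close> has index \<open>0\<close>,
  \<open>w\<close> lies in \<open>Y\<close> and solves \<open>(A + C) w = 0\<close>, so \<open>w = 0\<close>. On the other hand, splitting
  \<open>u\<^sub>k\<close> orthogonally in \<open>O\<close> along the discrete kernel, the kernel part is controlled in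
  \<open>Z\<close> by its norm in \<open>O\<close> and the other part by the inf-sup condition for \<open>a\<^sub>n\<close>. Hence
  \<open>u\<^sub>k \<rightarrow> 0\<close> in \<open>Z\<close>, contradicting the normalisation.
\<close>

section \<open>Hilbert space preliminaries\<close>

(* The minimiser of Q x = |x|^2 - 2 f x represents f; minimising sequences are Cauchy
   by the parallelogram law. *)
lemma riesz_representation:
  fixes f :: "'a::{real_inner,complete_space} \<Rightarrow> real"
  assumes f: "bounded_linear f"
  shows "\<exists>w. \<forall>v. w \<bullet> v = f v"
proof -
  interpret bounded_linear f by (rule f)
  define Q where "Q x = x \<bullet> x - 2 * f x" for x
  obtain K where K: "\<And>x. norm (f x) \<le> norm x * K" using bounded by blast
  \<comment> \<open>Completing the square: the bound on \<open>f\<close> gives Q x >= |x|^2 - 2 K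
    |x|.\<close>
  have "Q x \<ge> - K\<^sup>2" for x
  proof -
    have "f x \<le> norm x * K" using K[of x] by simp
    moreover have "0 \<le> (norm x - K)\<^sup>2" by simp
    ultimately show ?thesis
      unfolding Q_def by (simp add: power2_diff dot_square_norm)
  qed
  then have bdd: "bdd_below (range Q)" by (rule bdd_belowI2)
  define m where "m = Inf (range Q)"
  have mQ: "m \<le> Q x" for x unfolding m_def by (rule cInf_lower[OF _ bdd]) simp
  have "\<exists>x. Q x < m + 1 / Suc n" for n
    using cInf_lessD[of "range Q" "m + 1 / Suc n"] by (auto simp: m_def)
  then obtain x where x: "\<And>n. Q (x n) < m + 1 / Suc n" by metis
  have para: "(norm (y - z))\<^sup>2 = 2 * Q y + 2 * Q z - 4 * Q ((1/2) *\<^sub>R (y + z))" for y z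
    unfolding Q_def
    by (simp add: power2_norm_eq_inner inner_diff inner_add scaleR add algebra_simps inner_commute)
  have "Cauchy x"
  proof (rule metric_CauchyI)
    fix e :: real assume e: "e > 0"
    then obtain N where N: "4 / Suc N < e\<^sup>2"
      using reals_Archimedean[of "e\<^sup>2 / 4"] by (auto simp: field_simps)
    have "dist (x i) (x j) < e" if "i \<ge> N" "j \<ge> N" for i j
    proof -
      have "1 / Suc i \<le> 1 / Suc N" "1 / Suc j \<le> 1 / Suc N"
        using that by (auto simp: field_simps)
      then have "Q (x i) < m + 1 / Suc N" "Q (x j) < m + 1 / Suc N"
        using x[of i] x[of j] by linarith+
      then have "(norm (x i - x j))\<^sup>2 < 4 * (1 / Suc N)"
        using para[of "x i" "x j"] mQ[of "(1/2) *\<^sub>R (x i + x j)"] by linarith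
      then have "(norm (x i - x j))\<^sup>2 < e\<^sup>2" using N by simp
      then show ?thesis using e by (simp add: dist_norm power_less_imp_less_base)
    qed
    then show "\<exists>M. \<forall>i\<ge>M. \<forall>j\<ge>M. dist (x i) (x j) < e" by blast
  qed
  then obtain w where w: "x \<longlonglongrightarrow> w" using Cauchy_convergent convergent_def by blast
  have "(\<lambda>n. Q (x n)) \<longlonglongrightarrow> Q w"
    unfolding Q_def by (intro tendsto_intros tendsto w)
  moreover have "(\<lambda>n. m + 1 / Suc n) \<longlonglongrightarrow> m + 0"
    by (intro tendsto_intros LIMSEQ_Suc lim_1_over_n)
  ultimately have "Q w \<le> m + 0"
    by (rule LIMSEQ_le) (use x less_imp_le in blast)
  then have wmin: "Q w \<le> Q y" for y using mQ[of y] by simp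
  have "w \<bullet> v = f v" for v
  proof (cases "v = 0")
    case False
    define d where "d = w \<bullet> v - f v"
    \<comment> \<open>This \<open>t\<close> minimises the quadratic polynomial t -> Q (w + t v),
      whose minimum lies d^2 / |v|^2 below \<open>Q w\<close>; minimality of \<open>w\<close> then
      forces \<open>d\<close> to vanish.\<close>
    define t where "t = - d / (v \<bullet> v)"
    have pos: "v \<bullet> v > 0" using False by simp
    have "Q (w + t *\<^sub>R v) = Q w + 2 * t * d + t\<^sup>2 * (v \<bullet> v)"
      unfolding Q_def d_def
      by (simp add: inner_add inner_commute scaleR add algebra_simps power2_eq_square)
    also have "\<dots> = Q w - d\<^sup>2 / (v \<bullet> v)"
      using pos unfolding t_def by (simp add: field_simps power2_eq_square)
    finally have "d\<^sup>2 / (v \<bullet> v) \<le> 0" using wmin[of "w + t *\<^sub>R v"] by simp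
    then show ?thesis using pos unfolding d_def by (simp add: divide_le_0_iff)
  qed (simp add: zero)
  then show ?thesis by blast
qed

section \<open>Finite-dimensional subspaces and dimension counting\<close>

lemma finite_dim_subspace:
  assumes "finite_dim T" "S \<subseteq> T" "subspace S"
  shows "finite_dim S"
proof -
  obtain B where B: "finite B" "span B = T" using assms unfolding finite_dim_def by blast
  obtain D where D: "D \<subseteq> S" "independent D" "S \<subseteq> span D"
    using maximal_independent_subset .
  then have "finite D" using independent_span_bound[of B D] B assms by auto
  moreover have "span D = S" using D assms span_minimal by blast
  ultimately show ?thesis unfolding finite_dim_def by blast
qed

(* The orthogonal projection onto h ` S, read in the coordinates of S. *)
lemma lifted_orthogonal_projection:
  fixes h :: "'z::real_normed_vector \<Rightarrow> 'o::real_inner"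
  assumes h: "linear h" "inj h" and S: "finite_dim S"
  obtains R where "bounded_linear R" "\<And>x. R x \<in> S"
    "\<And>x s. s \<in> S \<Longrightarrow> (x - h (R x)) \<bullet> h s = 0" "\<And>s. s \<in> S \<Longrightarrow> R (h s) = s"
proof -
  obtain B where B: "finite B" "span B = S" using S unfolding finite_dim_def by blast
  obtain E where E: "finite E" "span E = span (h ` B)" "pairwise orthogonal E"
    using basis_orthogonal[of "h ` B"] B by auto
  have hS: "h ` S = span E" using E B linear_span_image[OF h(1), of B] by simp
  have subS: "subspace S" using B subspace_span by blast
  have "\<exists>s\<in>S. h s = e" if "e \<in> E" for e
    using hS span_base[OF that] by (metis imageE)
  then obtain r where r: "\<And>e. e \<in> E \<Longrightarrow> r e \<in> S \<and> h (r e) = e" by metis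
  \<comment> \<open>\<open>E\<close> is orthogonal but not normalised and may contain 0; there the
    quotient is 0 by convention and the term vanishes.\<close>
  define R where "R x = (\<Sum>e\<in>E. (x \<bullet> e / (e \<bullet> e)) *\<^sub>R r e)" for x
  have blR: "bounded_linear R"
  proof -
    have "bounded_linear (\<lambda>x. (x \<bullet> e / (e \<bullet> e)) *\<^sub>R r e)" for e
      unfolding divide_inverse
      by (intro bounded_linear_scaleR_const bounded_linear_mult_const bounded_linear_inner_left)
    then show ?thesis unfolding R_def by (intro bounded_linear_sum)
  qed
  have RS: "R x \<in> S" for x
    unfolding R_def using r subS by (intro subspace_sum subspace_scale) auto
  have hR: "h (R x) = (\<Sum>e\<in>E. (x \<bullet> e / (e \<bullet> e)) *\<^sub>R e)" for x
    unfolding R_def using r by (simp add: linear_sum[OF h(1)] linear_scale[OF h(1)])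
  have orthE: "(x - h (R x)) \<bullet> e = 0" if e: "e \<in> E" for x e
  proof -
    have "h (R x) \<bullet> e = (\<Sum>e'\<in>E. if e' = e then x \<bullet> e else 0)"
      unfolding hR inner_sum_left
      using E(3) e by (intro sum.cong refl) (auto simp: pairwise_def orthogonal_def)
    also have "\<dots> = x \<bullet> e" using E(1) e by simp
    finally show ?thesis by (simp add: inner_diff_left)
  qed
  have orth: "(x - h (R x)) \<bullet> h s = 0" if "s \<in> S" for x s
  proof -
    have "h s \<in> span E" using hS that by blast
    then show ?thesis
      using orthogonal_to_span[of "h s" E "x - h (R x)"] orthE
      by (simp add: orthogonal_def inner_commute)
  qed
  have "R (h s) = s" if s: "s \<in> S" for s
  proof -
    have "s - R (h s) \<in> S" using subS s RS subspace_diff by blast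
    then have "(h s - h (R (h s))) \<bullet> (h s - h (R (h s))) = 0"
      using orth[of "s - R (h s)" "h s"] by (simp add: linear_diff[OF h(1)])
    then show ?thesis using h(2) by (simp add: inj_eq)
  qed
  then show thesis using that blR RS orth by blast
qed

text \<open>A basis of \<open>W\<close> through a nonzero \<open>w\<close> loses a vector under
  \<open>P\<close>, so fewer than dim W vectors span the image of \<open>W\<close>. That image
  cannot contain the dim K independent vectors that \<open>g\<close> makes from a basis of
  \<open>K\<close>.\<close>

lemma kernel_trivial_of_dim:
  fixes g :: "'a::real_vector \<Rightarrow> 'b::real_vector" and P :: "'c::real_vector \<Rightarrow> 'b"
  assumes g: "linear g" "inj g" and P: "linear P" and W: "finite_dim W"
    and sub: "g ` K \<subseteq> P ` W" and dim: "dim K = dim W"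
    and w: "w \<in> W" "P w = 0"
  shows "w = 0"
proof (rule ccontr)
  assume w0: "w \<noteq> 0"
  obtain B where B: "{w} \<subseteq> B" "B \<subseteq> W" "independent B" "W \<subseteq> span B"
    using maximal_independent_subset_extend[of "{w}" W] w w0 by auto
  obtain T where "finite T" "span T = W" using W unfolding finite_dim_def by blast
  then have finB: "finite B" using independent_span_bound[of T B] B by auto
  obtain D where D: "D \<subseteq> K" "independent D" "card D = dim K"
    using basis_exists by metis
  have "P ` W \<subseteq> P ` span B" using B by blast
  also have "\<dots> = span (P ` B)" using linear_span_image[OF P] by simp
  also have "P ` B = insert 0 (P ` (B - {w}))" using B w by auto
  also have "span (insert 0 (P ` (B - {w}))) = span (P ` (B - {w}))" by simp
  finally have "g ` D \<subseteq> span (P ` (B - {w}))" using D sub by blast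
  moreover have "independent (g ` D)"
    using linear_independent_injective_image[OF g(1)] D g(2) by (metis inj_on_subset subset_UNIV)
  ultimately have "card (g ` D) \<le> card (P ` (B - {w}))"
    using independent_span_bound[of "P ` (B - {w})" "g ` D"] finB by simp
  moreover have "card (P ` (B - {w})) \<le> card (B - {w})" using finB card_image_le by blast
  moreover have "card (B - {w}) < card B" using finB B(1) by (intro card_Diff1_less) auto
  moreover have "card B = dim W" using B basis_card_eq_dim by blast
  moreover have "card (g ` D) = card D" using g(2) by (metis card_image inj_on_subset subset_UNIV)
  ultimately show False using D dim by simp
qed

lemma continuous_zero_on_dense:
  fixes f :: "'a::topological_space \<Rightarrow> real"
  assumes "closure S = UNIV" "continuous_on UNIV f" "\<And>x. x \<in> S \<Longrightarrow> f x = 0"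
  shows "f x = 0"
  using continuous_constant_on_closure[of S f 0 x] assms by simp

section \<open>The continuous problem\<close>

context abstract_setting
begin

abbreviation A :: "'y \<Rightarrow> 'o" where "A \<equiv> induced_operator aO"

text \<open>Riesz gives existence, and testing against all vectors gives uniqueness, so the definite
  description in \<open>induced_operator\<close> denotes.\<close>

lemma A_inner: "A u \<bullet> w = aO u w"
proof -
  interpret aO: bounded_bilinear aO by (rule continuous_aO)
  obtain z where z: "\<forall>v. z \<bullet> v = aO u v"
    using riesz_representation[OF aO.bounded_linear_right] by blast
  have "(THE w. \<forall>v. w \<bullet> v = aO u v) = z"
  proof (rule the_equality)
    fix w assume "\<forall>v. w \<bullet> v = aO u v"
    then have "w \<bullet> v = z \<bullet> v" for v using z by simp
    then show "w = z" by (metis vector_eq_rdot)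
  qed (rule z)
  then show ?thesis using z by (simp add: induced_operator_def)
qed

lemma \<iota>_bounded_linear: "bounded_linear \<iota>" and \<iota>_inj: "inj \<iota>"
  and \<kappa>_bounded_linear: "bounded_linear \<kappa>" and \<kappa>_inj: "inj \<kappa>"
  using embedding_ZO embedding_YZ by (auto simp: continuous_embedding_def)

lemma \<iota>\<kappa>_bounded_linear: "bounded_linear (\<iota> \<circ> \<kappa>)" and \<iota>\<kappa>_inj: "inj (\<iota> \<circ> \<kappa>)"
  using bounded_linear_compose[OF \<iota>_bounded_linear \<kappa>_bounded_linear]
  by (auto simp: comp_def intro: inj_compose[OF \<iota>_inj \<kappa>_inj, unfolded comp_def])

text \<open>Test vectors from Y suffice, since their images are dense in O.\<close>

lemma A_eq_0_iff: "A u = 0 \<longleftrightarrow> (\<forall>v. a u v = 0)"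
proof
  assume "A u = 0"
  then show "\<forall>v. a u v = 0" by (metis A_inner extends_aO inner_zero_left)
next
  assume u: "\<forall>v. a u v = 0"
  have "A u \<bullet> w = 0" for w
  proof (rule continuous_zero_on_dense[OF dense_YO])
    show "continuous_on UNIV (\<lambda>w. A u \<bullet> w)" by (intro continuous_intros)
  qed (auto simp: A_inner extends_aO u)
  then show "A u = 0" using inner_eq_zero_iff by blast
qed

lemma form_kernel_a: "form_kernel UNIV a = {u. A u = 0}"
  by (auto simp: form_kernel_def A_eq_0_iff)

(* Self-adjointness gives one inclusion of "range A is the orthogonal complement of ker A";
   index 0 gives this one, by counting dimensions. *)
lemma range_A:
  assumes y: "\<And>g. A g = 0 \<Longrightarrow> y \<bullet> \<iota> (\<kappa> g) = 0"
  shows "\<exists>x. A x = y"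
proof -
  let ?K = "{u. A u = 0}"
  obtain W where W: "finite_dim W" "range A \<inter> W = {0}"
      "\<forall>y. \<exists>x. \<exists>w\<in>W. y = A x + w" "int (dim ?K) - int (dim W) = 0"
    and K: "finite_dim ?K"
    using fredholm_A unfolding fredholm_of_index_def by blast
  obtain R where R: "bounded_linear R" "\<And>x. R x \<in> ?K"
    "\<And>x s. s \<in> ?K \<Longrightarrow> (x - (\<iota> \<circ> \<kappa>) (R x)) \<bullet> (\<iota> \<circ> \<kappa>) s = 0" "\<And>s. s \<in> ?K \<Longrightarrow> R ((\<iota> \<circ> \<kappa>) s) = s"
    using lifted_orthogonal_projection[OF _ \<iota>\<kappa>_inj K] \<iota>\<kappa>_bounded_linear bounded_linear.linear
    by metis
  \<comment> \<open>\<open>P\<close> is the orthogonal projection of O onto the image of the kernel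
    of \<open>A\<close>. It annihilates the orthogonal complement of that image, which contains
    \<open>range A\<close> by symmetry of \<open>a\<close>.\<close>
  define P where "P = (\<iota> \<circ> \<kappa>) \<circ> R"
  interpret P: bounded_linear P
    unfolding P_def comp_assoc[symmetric] comp_def
    using bounded_linear_compose[OF \<iota>\<kappa>_bounded_linear R(1)] by (simp add: comp_def)
  have PA: "P z = 0" if z: "\<And>g. A g = 0 \<Longrightarrow> z \<bullet> \<iota> (\<kappa> g) = 0" for z
  proof -
    have "A (R z) = 0" using R(2) by blast
    then have "P z \<bullet> P z = 0"
      using z[of "R z"] R(3)[of "R z" z] by (simp add: P_def inner_diff_left)
    then show ?thesis by simp
  qed
  have P0: "P (A x) = 0" for x
  proof (rule PA)
    fix g assume g: "A g = 0"
    have "A x \<bullet> \<iota> (\<kappa> g) = a g x" by (simp add: A_inner extends_aO symmetric_a)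
    then show "A x \<bullet> \<iota> (\<kappa> g) = 0" using g A_eq_0_iff by simp
  qed
  obtain x w where xw: "w \<in> W" "y = A x + w" using W(3) by blast
  have "P w = 0" using PA[OF y] xw P0 by (simp add: P.add)
  \<comment> \<open>The image of \<open>W\<close> under \<open>P\<close> contains the image of the
    kernel in O, and index 0 makes the dimensions of \<open>W\<close> and of the kernel equal, so
    \<open>P\<close> is injective on \<open>W\<close>.\<close>
  have "w = 0"
  proof (rule kernel_trivial_of_dim)
    show "linear (\<iota> \<circ> \<kappa>)" using \<iota>\<kappa>_bounded_linear bounded_linear.linear by blast
    show "linear P" by (rule P.linear)
    show "dim ?K = dim W" using W(4) by simp
    show "(\<iota> \<circ> \<kappa>) ` ?K \<subseteq> P ` W"
    proof
      fix z assume "z \<in> (\<iota> \<circ> \<kappa>) ` ?K"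
      then obtain s where s: "s \<in> ?K" "z = (\<iota> \<circ> \<kappa>) s" by blast
      then have "P z = z" using R(4) by (simp add: P_def)
      moreover obtain x w where "w \<in> W" "z = A x + w" using W(3) by blast
      ultimately show "z \<in> P ` W" using P0 by (metis P.add add_0 imageI)
    qed
  qed (use \<iota>\<kappa>_inj W xw \<open>P w = 0\<close> in auto)
  then show ?thesis using xw by auto
qed

(* A very weak solution u is regular: C u is orthogonal to ker A, so - C u = A y for some y,
   and u differs from y by an element of the orthogonal complement of range A. *)
lemma very_weak_solution_zero:
  assumes inj: "inj (\<lambda>u. A u + C (\<iota> (\<kappa> u)))"
    and u: "\<And>v. aO v u + C u \<bullet> \<iota> (\<kappa> v) = 0"
  shows "u = 0"
proof -
  interpret C: bounded_linear C by (rule bounded_C)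
  interpret \<iota>\<kappa>: bounded_linear "\<iota> \<circ> \<kappa>" by (rule \<iota>\<kappa>_bounded_linear)
  interpret A: bounded_linear A using fredholm_A by (simp add: fredholm_of_index_def)
  have "\<exists>y. A y = - C u"
  proof (rule range_A)
    fix g assume "A g = 0"
    then have "aO g u = 0" by (metis A_inner inner_zero_left)
    then show "- C u \<bullet> \<iota> (\<kappa> g) = 0" using u[of g] by simp
  qed
  then obtain y where y: "A y = - C u" by blast
  define d where "d = u - \<iota> (\<kappa> y)"
  \<comment> \<open>By symmetry of \<open>a\<close>, pairing \<open>A v\<close> with
    \<open>y\<close> gives the same value as the equation for \<open>u\<close> gives for pairing
    \<open>A v\<close> with \<open>u\<close>.\<close>
  have Ad: "A v \<bullet> d = 0" for v
  proof -
    have "A v \<bullet> \<iota> (\<kappa> y) = A y \<bullet> \<iota> (\<kappa> v)" by (simp add: A_inner extends_aO symmetric_a)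
    then show ?thesis using u[of v] y by (simp add: d_def inner_diff_right A_inner)
  qed
  have K: "finite_dim {u. A u = 0}" using fredholm_A unfolding fredholm_of_index_def by blast
  obtain R where R: "\<And>x. R x \<in> {u. A u = 0}"
    "\<And>x s. s \<in> {u. A u = 0} \<Longrightarrow> (x - (\<iota> \<circ> \<kappa>) (R x)) \<bullet> (\<iota> \<circ> \<kappa>) s = 0"
    using lifted_orthogonal_projection[OF \<iota>\<kappa>.linear \<iota>\<kappa>_inj K] by metis
  \<comment> \<open>\<open>r\<close> is orthogonal to the kernel, hence lies in
    \<open>range A\<close>; \<open>d\<close> and the kernel are both orthogonal to that range, so
    \<open>r\<close> is orthogonal to itself.\<close>
  define r where "r = d - \<iota> (\<kappa> (R d))"
  obtain x where x: "A x = r" using range_A[of r] R(2)[of _ d] by (auto simp: r_def)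
  have "A x \<bullet> \<iota> (\<kappa> (R d)) = 0" using R(2)[OF R(1), of d d] x by (simp add: r_def)
  then have "r \<bullet> r = 0" using Ad[of x] x by (simp add: r_def inner_diff_right)
  then have "r = 0" by simp
  then have "u = \<iota> (\<kappa> (y + R d))"
    using \<iota>\<kappa>.add by (simp add: r_def d_def algebra_simps)
  moreover have "A (y + R d) = - C u" using y R(1) by (simp add: A.add)
  \<comment> \<open>Thus \<open>u\<close> comes from \<open>y + R d\<close> in Y, which solves the
    equation strongly and is compared with 0 by injectivity.\<close>
  ultimately have "A (y + R d) + C (\<iota> (\<kappa> (y + R d))) = A 0 + C (\<iota> (\<kappa> 0))"
    using \<iota>\<kappa>.zero by (simp add: C.zero A.zero)
  then have "y + R d = 0" using inj by (simp add: inj_def)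
  then show ?thesis using \<open>u = _\<close> \<iota>\<kappa>.zero by simp
qed

end

section \<open>Discrete estimates\<close>

lemma symmetric_bilinear_on_commute:
  "symmetric_bilinear_on S b \<Longrightarrow> u \<in> S \<Longrightarrow> v \<in> S \<Longrightarrow> b u v = b v u"
  and symmetric_bilinear_on_add:
  "symmetric_bilinear_on S b \<Longrightarrow> u \<in> S \<Longrightarrow> v \<in> S \<Longrightarrow> w \<in> S \<Longrightarrow> b (u + v) w = b u w + b v w"
  and symmetric_bilinear_on_scale:
  "symmetric_bilinear_on S b \<Longrightarrow> u \<in> S \<Longrightarrow> v \<in> S \<Longrightarrow> b (r *\<^sub>R u) v = r * b u v"
  unfolding symmetric_bilinear_on_def by blast+

lemma symmetric_bilinear_on_zero:
  assumes "symmetric_bilinear_on S b" "u \<in> S" "0 \<in> S"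
  shows "b 0 u = 0" "b u 0 = 0"
  using symmetric_bilinear_on_scale[OF assms(1,2,2), of 0]
    symmetric_bilinear_on_commute[OF assms(1,2,3)] by simp_all

lemma symmetric_bilinear_on_plus:
  assumes "symmetric_bilinear_on S b" "symmetric_bilinear_on S c"
  shows "symmetric_bilinear_on S (\<lambda>u v. b u v + c u v)"
  using assms unfolding symmetric_bilinear_on_def by (simp add: algebra_simps)

lemma subspace_form_kernel:
  assumes "subspace S" "symmetric_bilinear_on S b"
  shows "subspace (form_kernel S b)"
  using assms
  by (auto simp: subspace_def form_kernel_def symmetric_bilinear_on_zero
      symmetric_bilinear_on_add symmetric_bilinear_on_scale)

section \<open>Real estimates extracted from the gap and the inf-sup constant\<close>

lemma SUP_ennreal_lessD:
  assumes "(SUP x\<in>S. ennreal (f x)) < ennreal r" "x \<in> S" "0 \<le> f x"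
  shows "f x < r"
proof -
  have "ennreal (f x) \<le> (SUP x\<in>S. ennreal (f x))" using assms(2) by (rule SUP_upper)
  then have "ennreal (f x) < ennreal r" using assms(1) by (rule le_less_trans)
  then show ?thesis using assms(3) by (simp add: ennreal_less_iff)
qed

text \<open>Only unit vectors enter the gap, so \<open>u\<close> is normalised and the approximant
  rescaled; the strict bound on the infimum provides an actual approximant.\<close>

lemma gap_lessD:
  assumes "gap E F < ennreal r" "subspace E" "subspace F" "u \<in> E"
  shows "\<exists>v\<in>F. norm (u - v) \<le> r * norm u"
proof (cases "u = 0")
  case True
  then show ?thesis using assms(3) subspace_0 by fastforce
next
  case False
  define w where "w = u /\<^sub>R norm u"
  have "w \<in> {u \<in> E. norm u = 1}"
    using False assms(2,4) by (simp add: w_def subspace_scale)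
  then have "(INF v\<in>F. ennreal (norm (w - v))) \<le> gap E F"
    unfolding gap_def by (rule SUP_upper)
  then have "(INF v\<in>F. ennreal (norm (w - v))) < ennreal r" using assms(1) by (rule le_less_trans)
  then obtain v where v: "v \<in> F" "norm (w - v) < r"
    by (auto simp: INF_less_iff ennreal_less_iff)
  have "u - norm u *\<^sub>R v = norm u *\<^sub>R (w - v)"
    using False by (simp add: w_def scaleR_diff_right)
  then have "norm (u - norm u *\<^sub>R v) = norm u * norm (w - v)" by simp
  also have "\<dots> \<le> r * norm u" using mult_left_mono[OF less_imp_le[OF v(2)], of "norm u"] by (simp add: mult.commute)
  finally show ?thesis using v(1) assms(3) subspace_scale by blast
qed

text \<open>The inf-sup condition as a stability estimate: a dual-norm bound on the functional
  \<open>b u\<close> controls \<open>u\<close> itself.\<close>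

lemma inf_sup_le_residual:
  assumes "ennreal \<beta> \<le> inf_sup U V b" "u \<in> U" "0 \<le> r"
    and res: "\<And>v. v \<in> V \<Longrightarrow> \<bar>b u v\<bar> \<le> r * norm v"
  shows "\<beta> * norm u \<le> r"
proof (cases "u = 0")
  case False
  then have "ennreal \<beta> \<le> (SUP v\<in>V - {0}. ennreal (\<bar>b u v\<bar> / (norm u * norm v)))"
    using assms(1,2) unfolding inf_sup_def le_INF_iff by blast
  also have "\<dots> \<le> ennreal (r / norm u)"
  proof (rule SUP_least)
    fix v assume v: "v \<in> V - {0}"
    then have "\<bar>b u v\<bar> / (norm u * norm v) \<le> r / norm u"
      using res[of v] False by (simp add: field_simps)
    then show "ennreal (\<bar>b u v\<bar> / (norm u * norm v)) \<le> ennreal (r / norm u)"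
      by (rule ennreal_leI)
  qed
  finally have "\<beta> \<le> r / norm u" using assms(3) by (simp add: ennreal_le_iff)
  then show ?thesis using False by (simp add: field_simps)
qed (use assms(3) in simp)

text \<open>The strict bound on the infimum selects a near-kernel vector, which homogeneity in the
  first argument allows to normalise.\<close>

lemma inf_sup_lessD:
  assumes "inf_sup S S b < ennreal r" "subspace S" "symmetric_bilinear_on S b"
  shows "\<exists>u\<in>S. norm u = 1 \<and> (\<forall>v\<in>S. \<bar>b u v\<bar> \<le> r * norm v)"
proof -
  obtain u where u: "u \<in> S" "u \<noteq> 0"
    and sup: "(SUP v\<in>S - {0}. ennreal (\<bar>b u v\<bar> / (norm u * norm v))) < ennreal r"
    using assms(1) unfolding inf_sup_def INF_less_iff by blast
  define w where "w = u /\<^sub>R norm u"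
  have "\<bar>b w v\<bar> \<le> r * norm v" if v: "v \<in> S" for v
  proof (cases "v = 0")
    case True
    then show ?thesis
      using symmetric_bilinear_on_zero(2)[OF assms(3), of w] u assms(2)
      by (simp add: w_def subspace_scale subspace_0)
  next
    case False
    have "\<bar>b u v\<bar> / (norm u * norm v) < r"
      using SUP_ennreal_lessD[OF sup, of v] v False by simp
    then have "\<bar>b u v\<bar> / norm u \<le> r * norm v" using u False by (simp add: field_simps)
    moreover have "b w v = b u v / norm u"
      using symmetric_bilinear_on_scale[OF assms(3) u(1) v] by (simp add: w_def divide_inverse_commute)
    ultimately show ?thesis by simp
  qed
  moreover have "w \<in> S" "norm w = 1" using u assms(2) by (simp_all add: w_def subspace_scale)
  ultimately show ?thesis by blast
qed

section \<open>Uniform estimates in the discrete spaces and passage to the limit\<close>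

context discrete_setting
begin

lemma subspace_X: "subspace (X n)"
  using finite_dim_X[of n] unfolding finite_dim_def by (metis subspace_span)

abbreviation Gn :: "nat \<Rightarrow> 'z set" where "Gn n \<equiv> form_kernel (X n) (an n)"

lemma subspace_Gn: "subspace (Gn n)"
  by (rule subspace_form_kernel[OF subspace_X bilinear_an])

lemma finite_dim_Gn: "finite_dim (Gn n)"
  by (rule finite_dim_subspace[OF finite_dim_X _ subspace_Gn]) (auto simp: form_kernel_def)

(* On the finite-dimensional space G the norms of Z and O are equivalent; by the gap
   condition this persists, uniformly, on the discrete kernels. *)
lemma discrete_kernel_norm_bound:
  assumes gap: "(\<lambda>n. gap (Gn n) (\<kappa> ` form_kernel UNIV a)) \<longlonglongrightarrow> 0"
  shows "\<exists>M\<ge>0. \<forall>\<^sub>F n in sequentially. \<forall>g\<in>Gn n. norm g \<le> M * norm (\<iota> g)"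
proof -
  interpret \<iota>: bounded_linear \<iota> by (rule \<iota>_bounded_linear)
  let ?G = "\<kappa> ` form_kernel UNIV a"
  have "finite_dim {u. A u = 0}" using fredholm_A unfolding fredholm_of_index_def by blast
  then obtain B where B: "finite B" "span B = form_kernel UNIV a"
    unfolding finite_dim_def form_kernel_a by blast
  have spanG: "span (\<kappa> ` B) = ?G"
    using linear_span_image[OF bounded_linear.linear[OF \<kappa>_bounded_linear], of B] B(2) by simp
  then have G: "finite_dim ?G" "subspace ?G"
    using B(1) subspace_span[of "\<kappa> ` B"] unfolding finite_dim_def by auto
  \<comment> \<open>\<open>R\<close> inverts \<open>\<iota>\<close> on \<open>?G\<close>; its bound
    \<open>L\<close> below is the norm-equivalence constant.\<close>
  obtain R where "bounded_linear R" and R: "\<And>s. s \<in> ?G \<Longrightarrow> R (\<iota> s) = s"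
    using lifted_orthogonal_projection[OF \<iota>.linear \<iota>_inj G(1)] by metis
  interpret R: bounded_linear R by fact
  obtain K where K: "K > 0" "\<And>x. norm (\<iota> x) \<le> norm x * K" using \<iota>.pos_bounded by blast
  obtain L where L: "L > 0" "\<And>x. norm (R x) \<le> norm x * L" using R.pos_bounded by blast
  \<comment> \<open>With this \<open>e\<close> the error of replacing \<open>g\<close> by a nearby
    \<open>h\<close> in \<open>?G\<close> is at most half of \<open>norm g\<close> and can be
    absorbed on the left.\<close>
  define e where "e = 1 / (2 * (1 + K * L))"
  have "1 + K * L > 0" using K(1) L(1) by (simp add: add_pos_pos)
  then have e: "e > 0" "e * (1 + K * L) = 1 / 2" by (simp_all add: e_def)
  have "\<forall>\<^sub>F n in sequentially. gap (Gn n) ?G < ennreal e"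
    using gap e(1) by (intro order_tendstoD(2)) auto
  then have "\<forall>\<^sub>F n in sequentially. \<forall>g\<in>Gn n. norm g \<le> (2 * L) * norm (\<iota> g)"
  proof (rule eventually_mono, intro ballI)
    fix n g assume n: "gap (Gn n) ?G < ennreal e" and g: "g \<in> Gn n"
    obtain h where h: "h \<in> ?G" "norm (g - h) \<le> e * norm g"
      using gap_lessD[OF n subspace_Gn G(2) g] by blast
    have "norm h \<le> norm (\<iota> h) * L" using L(2)[of "\<iota> h"] R[OF h(1)] by simp
    also have "norm (\<iota> h) \<le> norm (\<iota> g) + norm (g - h) * K"
      using norm_triangle_sub[of "\<iota> h" "\<iota> g"] K(2)[of "g - h"]
      by (simp add: \<iota>.diff norm_minus_commute)
    finally have "norm h \<le> (norm (\<iota> g) + norm (g - h) * K) * L" using L(1) by simp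
    then have "norm g \<le> L * norm (\<iota> g) + (1 + K * L) * norm (g - h)"
      using norm_triangle_sub[of g h] by (simp add: algebra_simps)
    also have "(1 + K * L) * norm (g - h) \<le> (1 + K * L) * (e * norm g)"
      using h(2) K(1) L(1) by (intro mult_left_mono) auto
    also have "\<dots> = (e * (1 + K * L)) * norm g" by (simp only: ac_simps)
    also have "\<dots> = norm g / 2" by (simp only: e(2))
    finally show "norm g \<le> (2 * L) * norm (\<iota> g)" by simp
  qed
  then show ?thesis using L(1) by (intro exI[of _ "2 * L"]) auto
qed

text \<open>An estimate of Garding type: moving \<open>cn\<close> to the right-hand side leaves a
  small term and a term in the norm of O, along which compactness is available.\<close>

lemma inf_sup_up_to_compact:
  assumes gap: "(\<lambda>n. gap (Gn n) (\<kappa> ` form_kernel UNIV a)) \<longlonglongrightarrow> 0"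
    and cn: "\<And>n u v. u \<in> X n \<Longrightarrow> v \<in> X n \<Longrightarrow>
      \<bar>C (\<iota> u) \<bullet> \<iota> v - cn n u v\<bar> \<le> \<epsilon> n * norm u * norm v"
    and eps: "\<And>n. \<epsilon> n > 0" and \<beta>: "\<beta> > 0"
    and inf_sup: "\<And>n. inf_sup {u \<in> X n. \<iota> u \<in> (\<iota> ` Gn n)\<^sup>\<bottom>} (X n) (an n) \<ge> ennreal \<beta>"
  shows "\<exists>K. \<forall>\<^sub>F n in sequentially. \<forall>u\<in>X n. \<forall>r\<ge>0.
    (\<forall>v\<in>X n. \<bar>an n u v + cn n u v\<bar> \<le> r * norm v) \<longrightarrow>
    \<beta> * norm u \<le> r + \<epsilon> n * norm u + K * norm (\<iota> u)"
proof -
  interpret \<iota>: bounded_linear \<iota> by (rule \<iota>_bounded_linear)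
  interpret C: bounded_linear C by (rule bounded_C)
  obtain M where M: "M \<ge> 0" "\<forall>\<^sub>F n in sequentially. \<forall>g\<in>Gn n. norm g \<le> M * norm (\<iota> g)"
    using discrete_kernel_norm_bound[OF gap] by blast
  obtain K where K: "K > 0" "\<And>x. norm (\<iota> x) \<le> norm x * K" using \<iota>.pos_bounded by blast
  obtain L where L: "L > 0" "\<And>x. norm (C x) \<le> norm x * L" using C.pos_bounded by blast
  have "\<beta> * norm u \<le> r + \<epsilon> n * norm u + (L * K + \<beta> * M) * norm (\<iota> u)"
    if n: "\<forall>g\<in>Gn n. norm g \<le> M * norm (\<iota> g)" and u: "u \<in> X n" and r: "r \<ge> 0"
      and res: "\<forall>v\<in>X n. \<bar>an n u v + cn n u v\<bar> \<le> r * norm v" for n u r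
  proof -
    obtain R where R: "\<And>x. R x \<in> Gn n" "\<And>x s. s \<in> Gn n \<Longrightarrow> (x - \<iota> (R x)) \<bullet> \<iota> s = 0"
      using lifted_orthogonal_projection[OF \<iota>.linear \<iota>_inj finite_dim_Gn] by metis
    \<comment> \<open>\<open>g\<close> is the O-orthogonal projection of \<open>u\<close> onto the
      discrete kernel, so the remainder \<open>t\<close> is admissible in the inf-sup
      condition.\<close>
    define g where "g = R (\<iota> u)"
    define t where "t = u - g"
    have g: "g \<in> Gn n" "g \<in> X n" "\<And>v. v \<in> X n \<Longrightarrow> an n g v = 0"
      using R(1)[of "\<iota> u"] by (auto simp: g_def form_kernel_def)
    have tX: "t \<in> X n" using subspace_diff[OF subspace_X u g(2)] by (simp add: t_def)
    have orth: "\<iota> t \<bullet> \<iota> s = 0" if "s \<in> Gn n" for s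
      using R(2)[OF that, of "\<iota> u"] by (simp add: t_def g_def \<iota>.diff)
    then have t: "t \<in> {u \<in> X n. \<iota> u \<in> (\<iota> ` Gn n)\<^sup>\<bottom>}"
      using tX by (auto simp: orthogonal_comp_def orthogonal_def inner_commute)
    have "\<iota> u \<bullet> \<iota> g = \<iota> g \<bullet> \<iota> g" using orth[OF g(1)] by (simp add: t_def \<iota>.diff inner_diff_left)
    then have "norm (\<iota> g) * norm (\<iota> g) \<le> norm (\<iota> u) * norm (\<iota> g)"
      using norm_cauchy_schwarz[of "\<iota> u" "\<iota> g"] by (simp add: power2_norm_eq_inner flip: power2_eq_square)
    then have "norm (\<iota> g) \<le> norm (\<iota> u)"
      by (cases "\<iota> g = 0") (auto simp: mult_le_cancel_right)
    then have "M * norm (\<iota> g) \<le> M * norm (\<iota> u)" using M(1) by (rule mult_left_mono)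
    then have normg: "norm g \<le> M * norm (\<iota> u)" using n g(1) by fastforce
    \<comment> \<open>The terms come from the residual, from replacing \<open>cn\<close> by
      \<open>c\<close>, and from boundedness of \<open>C\<close> with one factor kept in the norm of
      O.\<close>
    define q where "q = r + \<epsilon> n * norm u + L * K * norm (\<iota> u)"
    have "\<beta> * norm t \<le> q"
    proof (rule inf_sup_le_residual[OF inf_sup t])
      show "0 \<le> q" using r eps[of n] L(1) K(1) by (simp add: q_def)
      fix v assume v: "v \<in> X n"
      have "an n u v = an n t v + an n g v"
        using symmetric_bilinear_on_add[OF bilinear_an tX g(2) v] by (simp add: t_def)
      then have eq: "an n t v = an n u v" using g(3)[OF v] by simp
      have "\<bar>C (\<iota> u) \<bullet> \<iota> v\<bar> \<le> norm (C (\<iota> u)) * norm (\<iota> v)" by (rule Cauchy_Schwarz_ineq2)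
      also have "\<dots> \<le> (norm (\<iota> u) * L) * (norm v * K)"
        by (intro mult_mono L(2) K(2)) (use L(1) in auto)
      finally have "\<bar>C (\<iota> u) \<bullet> \<iota> v\<bar> \<le> L * K * norm (\<iota> u) * norm v" by (simp add: ac_simps)
      then have "\<bar>an n u v\<bar> \<le> r * norm v + \<epsilon> n * norm u * norm v + L * K * norm (\<iota> u) * norm v"
        using cn[OF u v] res v by fastforce
      then show "\<bar>an n t v\<bar> \<le> q * norm v" by (simp add: eq q_def algebra_simps)
    qed
    moreover have "\<beta> * norm g \<le> \<beta> * (M * norm (\<iota> u))"
      using normg \<beta> by (intro mult_left_mono) auto
    moreover have "\<beta> * norm u \<le> \<beta> * norm g + \<beta> * norm t"
      using norm_triangle_ineq[of g t] \<beta> unfolding t_def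
      by (metis add_diff_cancel_left' add_diff_eq distrib_left less_imp_le mult_left_mono)
    ultimately show ?thesis by (simp add: q_def algebra_simps)
  qed
  then have "\<forall>\<^sub>F n in sequentially. \<forall>u\<in>X n. \<forall>r\<ge>0.
      (\<forall>v\<in>X n. \<bar>an n u v + cn n u v\<bar> \<le> r * norm v) \<longrightarrow>
      \<beta> * norm u \<le> r + \<epsilon> n * norm u + (L * K + \<beta> * M) * norm (\<iota> u)"
    by (intro eventually_mono[OF M(2)]) blast
  then show ?thesis by blast
qed

text \<open>The vectors \<open>u k\<close> are only bounded in Z but converge in O, which suffices
  because \<open>aO v\<close> and \<open>C\<close> are continuous on O. The approximants
  \<open>s\<close> of \<open>v\<close> serve as test vectors for the residuals.\<close>

lemma limit_is_very_weak_solution: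
  assumes s: "\<And>n. s n \<in> X n" "s \<longlonglongrightarrow> \<kappa> v"
    and an: "(\<lambda>n. SUP x\<in>X n - {0}. ennreal (\<bar>aO v (\<iota> x) - an n (s n) x\<bar> / norm x)) \<longlonglongrightarrow> 0"
    and cn: "\<And>n u v. u \<in> X n \<Longrightarrow> v \<in> X n \<Longrightarrow>
      \<bar>C (\<iota> u) \<bullet> \<iota> v - cn n u v\<bar> \<le> \<epsilon> n * norm u * norm v"
    and eps: "\<epsilon> \<longlonglongrightarrow> 0"
    and N: "filterlim N at_top sequentially"
    and u: "\<And>k. u k \<in> X (N k)" "\<And>k. norm (u k) = 1"
    and res: "\<And>k x. x \<in> X (N k) \<Longrightarrow> \<bar>an (N k) (u k) x + cn (N k) (u k) x\<bar> \<le> r k * norm x"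
      "r \<longlonglongrightarrow> 0"
    and lim: "(\<lambda>k. \<iota> (u k)) \<longlonglongrightarrow> w"
  shows "aO v w + C w \<bullet> \<iota> (\<kappa> v) = 0"
proof -
  interpret \<iota>: bounded_linear \<iota> by (rule \<iota>_bounded_linear)
  interpret C: bounded_linear C by (rule bounded_C)
  interpret aO: bounded_bilinear aO by (rule continuous_aO)
  have sN: "(\<lambda>k. s (N k)) \<longlonglongrightarrow> \<kappa> v" and epsN: "(\<lambda>k. \<epsilon> (N k)) \<longlonglongrightarrow> 0"
    using filterlim_compose[OF s(2) N] filterlim_compose[OF eps N] by simp_all
  have u0: "u k \<noteq> 0" for k using u(2)[of k] by auto
  \<comment> \<open>Since \<open>u k\<close> has unit norm in Z, its consistency error is one of the
    quotients under the supremum.\<close>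
  have "(\<lambda>k. aO v (\<iota> (u k)) - an (N k) (s (N k)) (u k)) \<longlonglongrightarrow> 0"
  proof (rule tendstoI)
    fix e :: real assume "e > 0"
    then have "\<forall>\<^sub>F n in sequentially.
        (SUP x\<in>X n - {0}. ennreal (\<bar>aO v (\<iota> x) - an n (s n) x\<bar> / norm x)) < ennreal e"
      using an by (intro order_tendstoD(2)) auto
    then have "\<forall>\<^sub>F k in sequentially.
        (SUP x\<in>X (N k) - {0}. ennreal (\<bar>aO v (\<iota> x) - an (N k) (s (N k)) x\<bar> / norm x)) < ennreal e"
      using N by (rule eventually_compose_filterlim)
    then show "\<forall>\<^sub>F k in sequentially. dist (aO v (\<iota> (u k)) - an (N k) (s (N k)) (u k)) 0 < e"
    proof (rule eventually_mono)
      fix k assume "(SUP x\<in>X (N k) - {0}.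
        ennreal (\<bar>aO v (\<iota> x) - an (N k) (s (N k)) x\<bar> / norm x)) < ennreal e"
      from SUP_ennreal_lessD[OF this, of "u k"]
      show "dist (aO v (\<iota> (u k)) - an (N k) (s (N k)) (u k)) 0 < e"
        using u u0 by simp
    qed
  qed
  moreover have "(\<lambda>k. aO v (\<iota> (u k))) \<longlonglongrightarrow> aO v w"
    by (intro aO.tendsto tendsto_const lim)
  ultimately have "(\<lambda>k. aO v (\<iota> (u k)) - (aO v (\<iota> (u k)) - an (N k) (s (N k)) (u k)))
      \<longlonglongrightarrow> aO v w - 0"
    by (intro tendsto_diff)
  \<comment> \<open>Symmetry of \<open>an\<close> turns the approximant, first argument in the
    consistency condition, into the test vector.\<close>
  then have an_lim: "(\<lambda>k. an (N k) (u k) (s (N k))) \<longlonglongrightarrow> aO v w"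
    using symmetric_bilinear_on_commute[OF bilinear_an u(1) s(1)] by simp
  have "(\<lambda>k. C (\<iota> (u k)) \<bullet> \<iota> (s (N k)) - cn (N k) (u k) (s (N k))) \<longlonglongrightarrow> 0"
  proof (rule Lim_null_comparison)
    show "\<forall>\<^sub>F k in sequentially. norm (C (\<iota> (u k)) \<bullet> \<iota> (s (N k)) - cn (N k) (u k) (s (N k)))
        \<le> \<epsilon> (N k) * norm (s (N k))"
      using cn[OF u(1) s(1)] u(2) by (intro always_eventually) simp
    show "(\<lambda>k. \<epsilon> (N k) * norm (s (N k))) \<longlonglongrightarrow> 0"
      using tendsto_mult[OF epsN tendsto_norm[OF sN]] by simp
  qed
  moreover have "(\<lambda>k. C (\<iota> (u k)) \<bullet> \<iota> (s (N k))) \<longlonglongrightarrow> C w \<bullet> \<iota> (\<kappa> v)"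
    by (intro tendsto_inner C.tendsto \<iota>.tendsto lim sN)
  ultimately have "(\<lambda>k. C (\<iota> (u k)) \<bullet> \<iota> (s (N k)) -
      (C (\<iota> (u k)) \<bullet> \<iota> (s (N k)) - cn (N k) (u k) (s (N k)))) \<longlonglongrightarrow> C w \<bullet> \<iota> (\<kappa> v) - 0"
    by (intro tendsto_diff)
  then have cn_lim: "(\<lambda>k. cn (N k) (u k) (s (N k))) \<longlonglongrightarrow> C w \<bullet> \<iota> (\<kappa> v)" by simp
  have "(\<lambda>k. an (N k) (u k) (s (N k)) + cn (N k) (u k) (s (N k))) \<longlonglongrightarrow> 0"
  proof (rule Lim_null_comparison)
    show "\<forall>\<^sub>F k in sequentially. norm (an (N k) (u k) (s (N k)) + cn (N k) (u k) (s (N k)))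
        \<le> r k * norm (s (N k))"
      using res(1)[OF s(1)] by (intro always_eventually) simp
    show "(\<lambda>k. r k * norm (s (N k))) \<longlonglongrightarrow> 0"
      using tendsto_mult[OF res(2) tendsto_norm[OF sN]] by simp
  qed
  then show ?thesis using LIMSEQ_unique[OF tendsto_add[OF an_lim cn_lim]] by simp
qed

end

section \<open>The contradiction by compactness\<close>

theorem proposition6p3:
  fixes \<kappa> :: "'y::{real_inner,complete_space} \<Rightarrow> 'z::real_normed_vector"
    and \<iota> :: "'z \<Rightarrow> 'o::{real_inner,complete_space}"
    and a :: "'y \<Rightarrow> 'y \<Rightarrow> real"
    and aO :: "'y \<Rightarrow> 'o \<Rightarrow> real"
    and C :: "'o \<Rightarrow> 'o"
    and X :: "nat \<Rightarrow> 'z set"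
    and an :: "nat \<Rightarrow> 'z \<Rightarrow> 'z \<Rightarrow> real"
    and cn :: "nat \<Rightarrow> 'z \<Rightarrow> 'z \<Rightarrow> real"
    and Yinf :: "'y set"
    and \<epsilon> :: "nat \<Rightarrow> real"
    and \<beta> :: real
  assumes setting: "discrete_setting \<kappa> \<iota> a aO C X an cn"
    and i_dense: "closure Yinf = UNIV"
    and i_approx: "\<And>u. u \<in> Yinf \<Longrightarrow>
      \<exists>s :: nat \<Rightarrow> 'z. (\<forall>n. s n \<in> X n) \<and> s \<longlonglongrightarrow> \<kappa> u \<and>
        (\<lambda>n. SUP v\<in>X n - {0}. ennreal (\<bar>aO u (\<iota> v) - an n (s n) v\<bar> / norm v)) \<longlonglongrightarrow> 0"
    and ii: "(\<lambda>n. gap (form_kernel (X n) (an n)) (\<kappa> ` form_kernel UNIV a)) \<longlonglongrightarrow> 0"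
    and iii_eps: "\<And>n. \<epsilon> n > 0" "\<epsilon> \<longlonglongrightarrow> 0"
    and iii: "\<And>n u v. u \<in> X n \<Longrightarrow> v \<in> X n \<Longrightarrow>
      \<bar>C (\<iota> u) \<bullet> \<iota> v - cn n u v\<bar> \<le> \<epsilon> n * norm u * norm v"
    and iv_pos: "\<beta> > 0"
    and iv: "\<And>n. inf_sup {u \<in> X n. \<iota> u \<in> (\<iota> ` form_kernel (X n) (an n))\<^sup>\<bottom>} (X n) (an n) \<ge> ennreal \<beta>"
    and v: "inj (\<lambda>u. induced_operator aO u + C (\<iota> (\<kappa> u)))"
  shows "\<exists>\<beta>'>0. \<forall>\<^sub>F n in sequentially.
      inf_sup (X n) (X n) (\<lambda>u v. an n u v + cn n u v) \<ge> ennreal \<beta>'"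
proof (rule ccontr)
  interpret discrete_setting \<kappa> \<iota> a aO C X an cn by (rule setting)
  interpret \<iota>: bounded_linear \<iota> by (rule \<iota>_bounded_linear)
  interpret \<iota>\<kappa>: bounded_linear "\<iota> \<circ> \<kappa>" by (rule \<iota>\<kappa>_bounded_linear)
  interpret aO: bounded_bilinear aO by (rule continuous_aO)
  assume neg: "\<not> ?thesis"
  have "\<exists>n u. n \<ge> k \<and> u \<in> X n \<and> norm u = 1 \<and>
      (\<forall>v\<in>X n. \<bar>an n u v + cn n u v\<bar> \<le> 1 / Suc k * norm v)" for k
  proof -
    \<comment> \<open>The candidate constant 1 / Suc k fails at arbitrarily large indices, in
      particular at one beyond \<open>k\<close>.\<close>
    have "\<not> (\<forall>\<^sub>F n in sequentially.
        inf_sup (X n) (X n) (\<lambda>u v. an n u v + cn n u v) \<ge> ennreal (1 / Suc k))"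
      using neg by (auto dest!: spec[of _ "1 / Suc k"])
    then obtain n where n: "n \<ge> k"
      "inf_sup (X n) (X n) (\<lambda>u v. an n u v + cn n u v) < ennreal (1 / Suc k)"
      unfolding eventually_sequentially by (meson not_le)
    show ?thesis
      using inf_sup_lessD[OF n(2) subspace_X symmetric_bilinear_on_plus[OF bilinear_an bilinear_cn]] n(1)
      by blast
  qed
  then obtain n u where n: "\<And>k. n k \<ge> k" and u: "\<And>k. u k \<in> X (n k)" "\<And>k. norm (u k) = 1"
    and res: "\<And>k v. v \<in> X (n k) \<Longrightarrow>
      \<bar>an (n k) (u k) v + cn (n k) (u k) v\<bar> \<le> 1 / Suc k * norm v"
    by metis
  have "bounded (range u)" using u(2) by (auto simp: bounded_iff)
  then have "compact (closure (\<iota> ` range u))" using compact_ZO unfolding compact_map_def by blast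
  moreover have "\<iota> (u k) \<in> closure (\<iota> ` range u)" for k
    using closure_subset by fastforce
  ultimately obtain w \<rho> where \<rho>: "strict_mono \<rho>" and lim: "(\<lambda>k. \<iota> (u (\<rho> k))) \<longlonglongrightarrow> w"
    unfolding compact_def by (force simp: comp_def)
  \<comment> \<open>\<open>N\<close> need not be monotone; it diverges because n (\<rho> k) \<ge>
    \<rho> k.\<close>
  define N where "N k = n (\<rho> k)" for k
  have N: "filterlim N at_top sequentially"
    unfolding N_def
    by (rule filterlim_at_top_mono[OF filterlim_subseq[OF \<rho>]]) (simp add: n)
  define r :: "nat \<Rightarrow> real" where "r k = 1 / Suc (\<rho> k)" for k
  have r: "r \<longlonglongrightarrow> 0"
    using LIMSEQ_subseq_LIMSEQ[OF LIMSEQ_Suc[OF lim_1_over_n[where 'a = real]] \<rho>]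
    by (simp add: r_def[abs_def] comp_def)
  have uX: "u (\<rho> k) \<in> X (N k)" for k using u(1) by (simp add: N_def)
  have resN: "\<bar>an (N k) (u (\<rho> k)) x + cn (N k) (u (\<rho> k)) x\<bar> \<le> r k * norm x"
    if "x \<in> X (N k)" for k x
    using res that by (simp add: N_def r_def)
  \<comment> \<open>The identity is proved on \<open>Yinf\<close> and extends to Y by density, both
    terms being continuous in \<open>v\<close>.\<close>
  have "aO v w + C w \<bullet> (\<iota> \<circ> \<kappa>) v = 0" for v
  proof (rule continuous_zero_on_dense[OF i_dense])
    have "bounded_linear (\<lambda>v. aO v w)" by (rule aO.bounded_linear_left)
    then show "continuous_on UNIV (\<lambda>v. aO v w + C w \<bullet> (\<iota> \<circ> \<kappa>) v)"
      by (intro continuous_intros linear_continuous_on \<iota>\<kappa>_bounded_linear)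
    fix v assume "v \<in> Yinf"
    then obtain s where s: "\<forall>n. s n \<in> X n" "s \<longlonglongrightarrow> \<kappa> v"
      "(\<lambda>n. SUP x\<in>X n - {0}. ennreal (\<bar>aO v (\<iota> x) - an n (s n) x\<bar> / norm x)) \<longlonglongrightarrow> 0"
      using i_approx by blast
    show "aO v w + C w \<bullet> (\<iota> \<circ> \<kappa>) v = 0"
      using limit_is_very_weak_solution[OF spec[OF s(1)] s(2,3) iii iii_eps(2) N uX u(2) resN r lim]
      by simp
  qed
  then have "w = 0" by (intro very_weak_solution_zero[OF v]) simp
  obtain K where "\<forall>\<^sub>F n in sequentially. \<forall>u\<in>X n. \<forall>r\<ge>0.
    (\<forall>v\<in>X n. \<bar>an n u v + cn n u v\<bar> \<le> r * norm v) \<longrightarrow>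
    \<beta> * norm u \<le> r + \<epsilon> n * norm u + K * norm (\<iota> u)"
    using inf_sup_up_to_compact[OF ii iii iii_eps(1) iv_pos iv] by blast
  from eventually_compose_filterlim[OF this N]
  have "\<forall>\<^sub>F k in sequentially. \<beta> \<le> r k + \<epsilon> (N k) + K * norm (\<iota> (u (\<rho> k)))"
  proof (rule eventually_mono)
    fix k
    assume "\<forall>u\<in>X (N k). \<forall>r\<ge>0.
      (\<forall>v\<in>X (N k). \<bar>an (N k) u v + cn (N k) u v\<bar> \<le> r * norm v) \<longrightarrow>
      \<beta> * norm u \<le> r + \<epsilon> (N k) * norm u + K * norm (\<iota> u)"
    from this[rule_format, OF uX, of "r k"] show "\<beta> \<le> r k + \<epsilon> (N k) + K * norm (\<iota> (u (\<rho> k)))"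
      using resN u(2) by (simp add: r_def)
  qed
  moreover have "(\<lambda>k. r k + \<epsilon> (N k) + K * norm (\<iota> (u (\<rho> k)))) \<longlonglongrightarrow> 0 + 0 + K * norm w"
    by (intro tendsto_intros r lim filterlim_compose[OF iii_eps(2) N])
  \<comment> \<open>The left side is the unit norm of \<open>u (\<rho> k)\<close> times \<beta>,
    while the limit on the right is 0 because \<open>w = 0\<close>.\<close>
  ultimately have "\<beta> \<le> 0 + 0 + K * norm w" by (intro tendsto_lowerbound) auto
  then show False using iv_pos \<open>w = 0\<close> by simp
qed

end
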